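(* Let $(M^{2n+1},\theta,\xi,\eta,g)$ be a nearly cosymplectic manifold. Then for $X,Y,Z$ and $W$ in $\mathcal F$ (at the same point), we have $$R(Y,X,W,Z)-R(Y,X,\theta W,\theta Z)=-g((\nabla_W\theta)(Z),(\nabla_Y\theta)(X))+g(Y,\nabla_X\xi)\,g(Z,\nabla_W\xi).$$
   Context: An almost contact (metric) structure on a Riemannian manifold $(M^{2n+1},g)$ consists of a $(1,1)$-tensor $\theta$, a 1-form $\eta$ and a unit vector field $\xi$ with $\theta^2=-\mathrm{Id}+\eta\otimes\xi$, $\eta(\xi)=1$, compatible with the metric: $g(\theta X,\theta Y)=g(X,Y)-\eta(X)\eta(Y)$ (so $\eta=g(\xi,\cdot)$, $\theta\xi=0$ and $\theta$ is skew-symmetric). It is nearly cosymplectic, and $(M,\theta,\xi,\eta,g)$ is a nearly cosymplectic manifold, if $(\nabla_X\theta)(Y)+(\nabla_Y\theta)(X)=0$ for all $X,Y$, where $\nabla$ is the Levi-Civita connection of $g$. $\mathcal F$ is the distribution orthogonal to $\xi$ (rank $2n$). The curvature conventions are $R(X,Y)=[\nabla_X,\nabla_Y]-\nabla_{[X,Y]}$ and $R(X,Y,Z,W)=g(R(X,Y)Z,W)$. *)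

theory Defs
  imports "HOL-Analysis.Analysis" "HOL-Library.Function_Algebras"
begin

text \<open>
  A manifold is a Hausdorff, second countable type \<open>'m\<close> with a smooth atlas of charts into a
  Euclidean space \<open>'e\<close>. The atlas need not be maximal. Tangent vectors at \<open>p\<close> are the derivations
  at \<open>p\<close> of the algebra of smooth functions, so a vector field is a map from points to functionals.
  Sums, differences and zero of tangent vectors and of vector fields are the pointwise ones of
  \<open>HOL-Library.Function_Algebras\<close>.
\<close>

type_synonym ('m, 'e) atlas = "('m set \<times> ('m \<Rightarrow> 'e)) set"
type_synonym 'm tangent = "('m \<Rightarrow> real) \<Rightarrow> real"
type_synonym 'm vfield = "'m \<Rightarrow> 'm tangent"

text \<open>Meant for open \<open>S\<close> in a finite-dimensional space: the derivatives are taken at interior points.\<close>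

primrec Ck_on :: "nat \<Rightarrow> 'a::euclidean_space set \<Rightarrow> ('a \<Rightarrow> 'b::euclidean_space) \<Rightarrow> bool" where
  "Ck_on 0 S f \<longleftrightarrow> continuous_on S f"
| "Ck_on (Suc k) S f \<longleftrightarrow>
     (\<forall>x\<in>S. f differentiable (at x)) \<and>
     (\<forall>v. Ck_on k S (\<lambda>x. frechet_derivative f (at x) v))"

definition Cinf_on :: "'a::euclidean_space set \<Rightarrow> ('a \<Rightarrow> 'b::euclidean_space) \<Rightarrow> bool" where
  "Cinf_on S f \<longleftrightarrow> (\<forall>k. Ck_on k S f)"

definition smooth_atlas ::
    "('m::{t2_space, second_countable_topology}, 'e::euclidean_space) atlas \<Rightarrow> bool" where
  "smooth_atlas A \<longleftrightarrow>
     (\<forall>(U, \<phi>)\<in>A. open U \<and> open (\<phi> ` U) \<and> homeomorphism U (\<phi> ` U) \<phi> (inv_into U \<phi>)) \<and>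
     (\<Union>(U, \<phi>)\<in>A. U) = UNIV \<and>
     (\<forall>(U, \<phi>)\<in>A. \<forall>(V, \<psi>)\<in>A. Cinf_on (\<phi> ` (U \<inter> V)) (\<psi> \<circ> inv_into U \<phi>))"

definition smooth_funs :: "('m, 'e::euclidean_space) atlas \<Rightarrow> ('m \<Rightarrow> real) set" where
  "smooth_funs A = {f. \<forall>(U, \<phi>)\<in>A. Cinf_on (\<phi> ` U) (f \<circ> inv_into U \<phi>)}"

text \<open>
  Functionals act on all functions, so a tangent vector is required to vanish on non-smooth ones;
  this makes equality of tangent vectors mean equality as derivations of smooth functions.
\<close>

definition tangent_space :: "('m, 'e::euclidean_space) atlas \<Rightarrow> 'm \<Rightarrow> 'm tangent set" where
  "tangent_space A p = {v.
     (\<forall>f. f \<notin> smooth_funs A \<longrightarrow> v f = 0) \<and>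
     (\<forall>f\<in>smooth_funs A. \<forall>h\<in>smooth_funs A. \<forall>a b.
        v (\<lambda>q. a * f q + b * h q) = a * v f + b * v h) \<and>
     (\<forall>f\<in>smooth_funs A. \<forall>h\<in>smooth_funs A.
        v (\<lambda>q. f q * h q) = f p * v h + h p * v f)}"

definition tscale :: "real \<Rightarrow> 'm tangent \<Rightarrow> 'm tangent" where
  "tscale c v = (\<lambda>f. c * v f)"

definition vscale :: "('m \<Rightarrow> real) \<Rightarrow> 'm vfield \<Rightarrow> 'm vfield" where
  "vscale h X = (\<lambda>p. tscale (h p) (X p))"

definition vderiv :: "'m vfield \<Rightarrow> ('m \<Rightarrow> real) \<Rightarrow> 'm \<Rightarrow> real" where
  "vderiv X f = (\<lambda>p. X p f)"

definition vfields :: "('m, 'e::euclidean_space) atlas \<Rightarrow> 'm vfield set" where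
  "vfields A = {X. (\<forall>p. X p \<in> tangent_space A p) \<and>
     (\<forall>f\<in>smooth_funs A. vderiv X f \<in> smooth_funs A)}"

text \<open>The case distinction keeps the bracket zero on non-smooth functions.\<close>

definition lie_bracket :: "('m, 'e::euclidean_space) atlas \<Rightarrow> 'm vfield \<Rightarrow> 'm vfield \<Rightarrow> 'm vfield" where
  "lie_bracket A X Y = (\<lambda>p f. if f \<in> smooth_funs A
     then X p (vderiv Y f) - Y p (vderiv X f) else 0)"

text \<open>
  Tensor fields are given pointwise; smoothness of a tensor field is expressed by its taking
  smooth vector fields to smooth vector fields or functions.
\<close>

definition riemannian_metric ::
    "('m, 'e::euclidean_space) atlas \<Rightarrow> ('m \<Rightarrow> 'm tangent \<Rightarrow> 'm tangent \<Rightarrow> real) \<Rightarrow> bool" where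
  "riemannian_metric A g \<longleftrightarrow>
     (\<forall>p. \<forall>u\<in>tangent_space A p. \<forall>v\<in>tangent_space A p. \<forall>w\<in>tangent_space A p. \<forall>a b.
        g p (tscale a u + tscale b v) w = a * g p u w + b * g p v w) \<and>
     (\<forall>p. \<forall>u\<in>tangent_space A p. \<forall>v\<in>tangent_space A p. g p u v = g p v u) \<and>
     (\<forall>p. \<forall>v\<in>tangent_space A p. v \<noteq> 0 \<longrightarrow> 0 < g p v v) \<and>
     (\<forall>X\<in>vfields A. \<forall>Y\<in>vfields A. (\<lambda>p. g p (X p) (Y p)) \<in> smooth_funs A)"

definition endo_app :: "('m \<Rightarrow> 'm tangent \<Rightarrow> 'm tangent) \<Rightarrow> 'm vfield \<Rightarrow> 'm vfield" where
  "endo_app \<theta> X = (\<lambda>p. \<theta> p (X p))"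

definition tensor_field_1_1 ::
    "('m, 'e::euclidean_space) atlas \<Rightarrow> ('m \<Rightarrow> 'm tangent \<Rightarrow> 'm tangent) \<Rightarrow> bool" where
  "tensor_field_1_1 A \<theta> \<longleftrightarrow>
     (\<forall>p. \<forall>v\<in>tangent_space A p. \<theta> p v \<in> tangent_space A p) \<and>
     (\<forall>p. \<forall>u\<in>tangent_space A p. \<forall>v\<in>tangent_space A p. \<forall>a b.
        \<theta> p (tscale a u + tscale b v) = tscale a (\<theta> p u) + tscale b (\<theta> p v)) \<and>
     (\<forall>X\<in>vfields A. endo_app \<theta> X \<in> vfields A)"

definition one_form ::
    "('m, 'e::euclidean_space) atlas \<Rightarrow> ('m \<Rightarrow> 'm tangent \<Rightarrow> real) \<Rightarrow> bool" where
  "one_form A \<eta> \<longleftrightarrow>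
     (\<forall>p. \<forall>u\<in>tangent_space A p. \<forall>v\<in>tangent_space A p. \<forall>a b.
        \<eta> p (tscale a u + tscale b v) = a * \<eta> p u + b * \<eta> p v) \<and>
     (\<forall>X\<in>vfields A. (\<lambda>p. \<eta> p (X p)) \<in> smooth_funs A)"

definition affine_connection ::
    "('m, 'e::euclidean_space) atlas \<Rightarrow> ('m vfield \<Rightarrow> 'm vfield \<Rightarrow> 'm vfield) \<Rightarrow> bool" where
  "affine_connection A D \<longleftrightarrow>
     (\<forall>X\<in>vfields A. \<forall>Y\<in>vfields A. D X Y \<in> vfields A) \<and>
     (\<forall>X\<in>vfields A. \<forall>Y\<in>vfields A. \<forall>Z\<in>vfields A.
        D (X + Y) Z = D X Z + D Y Z \<and> D X (Y + Z) = D X Y + D X Z) \<and>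
     (\<forall>X\<in>vfields A. \<forall>Y\<in>vfields A. \<forall>f\<in>smooth_funs A.
        D (vscale f X) Y = vscale f (D X Y) \<and>
        D X (vscale f Y) = vscale (vderiv X f) Y + vscale f (D X Y))"

definition levi_civita_connection ::
    "('m, 'e::euclidean_space) atlas \<Rightarrow> ('m \<Rightarrow> 'm tangent \<Rightarrow> 'm tangent \<Rightarrow> real)
      \<Rightarrow> ('m vfield \<Rightarrow> 'm vfield \<Rightarrow> 'm vfield) \<Rightarrow> bool" where
  "levi_civita_connection A g D \<longleftrightarrow>
     affine_connection A D \<and>
     (\<forall>X\<in>vfields A. \<forall>Y\<in>vfields A. D X Y - D Y X = lie_bracket A X Y) \<and>
     (\<forall>X\<in>vfields A. \<forall>Y\<in>vfields A. \<forall>Z\<in>vfields A. \<forall>p.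
        vderiv X (\<lambda>q. g q (Y q) (Z q)) p = g p (D X Y p) (Z p) + g p (Y p) (D X Z p))"

text \<open>\<open>cov_deriv_endo D \<theta> X Y\<close> is the vector field \<open>(\<nabla>\<^sub>X \<theta>)(Y)\<close>.\<close>

definition cov_deriv_endo :: "('m vfield \<Rightarrow> 'm vfield \<Rightarrow> 'm vfield)
    \<Rightarrow> ('m \<Rightarrow> 'm tangent \<Rightarrow> 'm tangent) \<Rightarrow> 'm vfield \<Rightarrow> 'm vfield \<Rightarrow> 'm vfield" where
  "cov_deriv_endo D \<theta> X Y = D X (endo_app \<theta> Y) - endo_app \<theta> (D X Y)"

definition curvature_op :: "('m, 'e::euclidean_space) atlas
    \<Rightarrow> ('m vfield \<Rightarrow> 'm vfield \<Rightarrow> 'm vfield)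
    \<Rightarrow> 'm vfield \<Rightarrow> 'm vfield \<Rightarrow> 'm vfield \<Rightarrow> 'm vfield" where
  "curvature_op A D X Y Z = D X (D Y Z) - D Y (D X Z) - D (lie_bracket A X Y) Z"

definition curvature :: "('m, 'e::euclidean_space) atlas
    \<Rightarrow> ('m \<Rightarrow> 'm tangent \<Rightarrow> 'm tangent \<Rightarrow> real)
    \<Rightarrow> ('m vfield \<Rightarrow> 'm vfield \<Rightarrow> 'm vfield)
    \<Rightarrow> 'm vfield \<Rightarrow> 'm vfield \<Rightarrow> 'm vfield \<Rightarrow> 'm vfield \<Rightarrow> 'm \<Rightarrow> real" where
  "curvature A g D X Y Z W p = g p (curvature_op A D X Y Z p) (W p)"

definition almost_contact_metric :: "('m, 'e::euclidean_space) atlas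
    \<Rightarrow> ('m \<Rightarrow> 'm tangent \<Rightarrow> 'm tangent \<Rightarrow> real)
    \<Rightarrow> ('m \<Rightarrow> 'm tangent \<Rightarrow> 'm tangent) \<Rightarrow> 'm vfield \<Rightarrow> ('m \<Rightarrow> 'm tangent \<Rightarrow> real) \<Rightarrow> bool" where
  "almost_contact_metric A g \<theta> \<xi> \<eta> \<longleftrightarrow>
     tensor_field_1_1 A \<theta> \<and> \<xi> \<in> vfields A \<and> one_form A \<eta> \<and>
     (\<forall>p. g p (\<xi> p) (\<xi> p) = 1) \<and>
     (\<forall>p. \<forall>v\<in>tangent_space A p. \<theta> p (\<theta> p v) = - v + tscale (\<eta> p v) (\<xi> p)) \<and>
     (\<forall>p. \<eta> p (\<xi> p) = 1) \<and>
     (\<forall>p. \<forall>u\<in>tangent_space A p. \<forall>v\<in>tangent_space A p.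
        g p (\<theta> p u) (\<theta> p v) = g p u v - \<eta> p u * \<eta> p v)"

text \<open>\<open>D\<close> is to be the Levi-Civita connection of \<open>g\<close>, which is unique.\<close>

definition nearly_cosymplectic :: "('m, 'e::euclidean_space) atlas
    \<Rightarrow> ('m \<Rightarrow> 'm tangent \<Rightarrow> 'm tangent \<Rightarrow> real)
    \<Rightarrow> ('m vfield \<Rightarrow> 'm vfield \<Rightarrow> 'm vfield)
    \<Rightarrow> ('m \<Rightarrow> 'm tangent \<Rightarrow> 'm tangent) \<Rightarrow> 'm vfield \<Rightarrow> ('m \<Rightarrow> 'm tangent \<Rightarrow> real) \<Rightarrow> bool" where
  "nearly_cosymplectic A g D \<theta> \<xi> \<eta> \<longleftrightarrow>
     almost_contact_metric A g \<theta> \<xi> \<eta> \<and>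
     (\<forall>X\<in>vfields A. \<forall>Y\<in>vfields A. cov_deriv_endo D \<theta> X Y + cov_deriv_endo D \<theta> Y X = 0)"

definition orth_distribution :: "('m, 'e::euclidean_space) atlas
    \<Rightarrow> ('m \<Rightarrow> 'm tangent \<Rightarrow> 'm tangent \<Rightarrow> real) \<Rightarrow> 'm vfield \<Rightarrow> 'm \<Rightarrow> 'm tangent set" where
  "orth_distribution A g \<xi> p = {v \<in> tangent_space A p. g p v (\<xi> p) = 0}"

end

theory Submission
  imports Defs
begin

text \<open>
  Let \<open>\<tau>(X, Y, Z) = g((\<nabla>\<^sub>X \<theta>)Y, Z)\<close>, a 3-form, and \<open>S = \<nabla>\<tau>\<close>. The Ricci identity expresses
  \<open>S(X; Y, Z, W) - S(Y; X, Z, W)\<close> through the curvature, and differentiating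
  \<open>\<theta>\<^sup>2 = - Id + \<eta> \<otimes> \<xi>\<close> twice expresses \<open>S(X; Y, \<theta>Z, W) - S(X; Y, Z, \<theta>W)\<close> on \<open>\<F>\<close> through
  \<open>q(X, Y, Z, W) = g((\<nabla>\<^sub>X \<theta>)Y, (\<nabla>\<^sub>Z \<theta>)W) + \<Phi>(X, Y) \<Phi>(Z, W)\<close>, where \<open>\<Phi>(X, Y) = g(\<nabla>\<^sub>X \<xi>, Y)\<close>.
  With the \<open>\<Phi>\<close>-term included, \<open>q\<close> has on \<open>\<F>\<close> the same symmetries as the first term alone has on a
  nearly Kaehler manifold, so the situation there is reproduced exactly:
  \<open>d(X, Y, Z, W) = R(X, Y, Z, W) - R(X, Y, \<theta>Z, \<theta>W) + q(X, Y, Z, W)\<close> is a 4-form by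
  polarization, and since \<open>\<tau>\<close> is closed it vanishes. General fields reduce to fields everywhere
  orthogonal to \<open>\<xi>\<close> because \<open>X - \<eta>(X) \<xi>\<close> agrees with \<open>X\<close> at \<open>p\<close> when \<open>X\<^sub>p \<in> \<F>\<close>.
\<close>

section \<open>Smooth functions and vector fields\<close>

text \<open>The differentiation rules determine \<open>frechet_derivative\<close> only at points of
  \<open>S\<close>; since \<open>S\<close> is open, derivatives there do not depend on values
  outside.\<close>

lemma Ck_on_cong:
  assumes "open S" "\<And>x. x \<in> S \<Longrightarrow> f x = h x" "Ck_on k S f"
  shows "Ck_on k S h"
  using assms(2,3)
proof (induction k arbitrary: f h)
  case 0
  then show ?case by (simp cong: continuous_on_cong)
next
  case (Suc k)
  have d: "(h has_derivative frechet_derivative f (at x)) (at x)" if "x \<in> S" for x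
  proof (rule has_derivative_transform_within_open[OF _ assms(1) that])
    show "(f has_derivative frechet_derivative f (at x)) (at x)"
      using Suc.prems(2) that by (simp add: frechet_derivative_works[symmetric])
  qed (rule Suc.prems(1))
  have eq: "frechet_derivative f (at x) = frechet_derivative h (at x)" if "x \<in> S" for x
    by (rule frechet_derivative_at[OF d[OF that]])
  have "Ck_on k S (\<lambda>x. frechet_derivative h (at x) v)" for v
    by (rule Suc.IH[of "\<lambda>x. frechet_derivative f (at x) v"]) (use Suc.prems(2) eq in auto)
  moreover have "h differentiable at x" if "x \<in> S" for x
    using d[OF that] by (auto simp: differentiable_def)
  ultimately show ?case by simp
qed

lemma Ck_on_Suc_imp: "Ck_on (Suc k) S f \<Longrightarrow> Ck_on k S f"
proof (induction k arbitrary: f)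
  case 0
  then show ?case
    by (simp add: continuous_at_imp_continuous_on differentiable_imp_continuous_within)
next
  case (Suc k)
  then show ?case by auto
qed

lemma Ck_on_add:
  fixes f h :: "'a::euclidean_space \<Rightarrow> real"
  assumes "open S" "Ck_on k S f" "Ck_on k S h"
  shows "Ck_on k S (\<lambda>x. f x + h x)"
  using assms(2,3)
proof (induction k arbitrary: f h)
  case 0
  then show ?case by (simp add: continuous_on_add)
next
  case (Suc k)
  have der: "((\<lambda>x. f x + h x) has_derivative
      (\<lambda>v. frechet_derivative f (at x) v + frechet_derivative h (at x) v)) (at x)" if "x \<in> S" for x
    using Suc.prems that by (intro has_derivative_add) (auto simp: frechet_derivative_works[symmetric])
  have eq: "frechet_derivative f (at x) v + frechet_derivative h (at x) v
      = frechet_derivative (\<lambda>x. f x + h x) (at x) v" if "x \<in> S" for x v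
    by (rule fun_cong[OF frechet_derivative_at]) (use that der in simp)
  have "Ck_on k S (\<lambda>x. frechet_derivative (\<lambda>x. f x + h x) (at x) v)" for v
    by (rule Ck_on_cong[OF assms(1) eq Suc.IH]) (use Suc.prems in simp_all)
  then show ?case using Suc.prems by simp
qed

lemma Ck_on_mult:
  fixes f h :: "'a::euclidean_space \<Rightarrow> real"
  assumes "open S" "Ck_on k S f" "Ck_on k S h"
  shows "Ck_on k S (\<lambda>x. f x * h x)"
  using assms(2,3)
proof (induction k arbitrary: f h)
  case 0
  then show ?case by (simp add: continuous_on_mult)
next
  case (Suc k)
  have der: "((\<lambda>x. f x * h x) has_derivative
      (\<lambda>v. f x * frechet_derivative h (at x) v + frechet_derivative f (at x) v * h x)) (at x)"
    if "x \<in> S" for x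
    using Suc.prems that by (intro has_derivative_mult) (auto simp: frechet_derivative_works[symmetric])
  have eq: "f x * frechet_derivative h (at x) v + frechet_derivative f (at x) v * h x
      = frechet_derivative (\<lambda>x. f x * h x) (at x) v" if "x \<in> S" for x v
    by (rule fun_cong[OF frechet_derivative_at]) (use that der in simp)
  have "Ck_on k S (\<lambda>x. frechet_derivative (\<lambda>x. f x * h x) (at x) v)" for v
    by (rule Ck_on_cong[OF assms(1) eq Ck_on_add[OF assms(1) Suc.IH Suc.IH]])
      (use Suc.prems Ck_on_Suc_imp[OF Suc.prems(1)] Ck_on_Suc_imp[OF Suc.prems(2)] in simp_all)
  then show ?case using Suc.prems by simp
qed

lemma Ck_on_const: "Ck_on k S (\<lambda>x. c)"
proof (induction k arbitrary: c)
  case (Suc k)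
  \<comment> \<open>The derivative of a constant is the constant 0, hence this instance.\<close>
  from Suc[of 0] show ?case by simp
qed simp

context
  fixes A :: "('m::{t2_space, second_countable_topology}, 'e::euclidean_space) atlas"
  assumes atlas: "smooth_atlas A"
begin

lemma chart_open: "(U, \<phi>) \<in> A \<Longrightarrow> open (\<phi> ` U)"
  using atlas by (auto simp: smooth_atlas_def)

lemma smooth_funs_add:
  "f \<in> smooth_funs A \<Longrightarrow> h \<in> smooth_funs A \<Longrightarrow> (\<lambda>p. f p + h p) \<in> smooth_funs A"
  unfolding smooth_funs_def Cinf_on_def o_def by (fast intro: Ck_on_add chart_open)

lemma smooth_funs_mult:
  "f \<in> smooth_funs A \<Longrightarrow> h \<in> smooth_funs A \<Longrightarrow> (\<lambda>p. f p * h p) \<in> smooth_funs A"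
  unfolding smooth_funs_def Cinf_on_def o_def by (fast intro: Ck_on_mult chart_open)

lemma smooth_funs_const: "(\<lambda>p. c) \<in> smooth_funs A"
  by (auto simp: smooth_funs_def Cinf_on_def o_def Ck_on_const)

lemma smooth_funs_diff:
  "f \<in> smooth_funs A \<Longrightarrow> h \<in> smooth_funs A \<Longrightarrow> (\<lambda>p. f p - h p) \<in> smooth_funs A"
  using smooth_funs_add[of f "\<lambda>p. - 1 * h p"] smooth_funs_mult[OF smooth_funs_const[of "- 1"]]
  by simp

lemma tangent_space_add:
  "u \<in> tangent_space A p \<Longrightarrow> v \<in> tangent_space A p \<Longrightarrow> u + v \<in> tangent_space A p"
  by (auto simp: tangent_space_def algebra_simps)

lemma tangent_space_diff:
  "u \<in> tangent_space A p \<Longrightarrow> v \<in> tangent_space A p \<Longrightarrow> u - v \<in> tangent_space A p"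
  by (auto simp: tangent_space_def algebra_simps)

lemma tangent_space_scale: "u \<in> tangent_space A p \<Longrightarrow> tscale c u \<in> tangent_space A p"
  by (auto simp: tangent_space_def tscale_def algebra_simps)

lemma vfields_add: "X \<in> vfields A \<Longrightarrow> Y \<in> vfields A \<Longrightarrow> X + Y \<in> vfields A"
  by (auto simp: vfields_def vderiv_def intro!: tangent_space_add smooth_funs_add)

lemma vfields_diff: "X \<in> vfields A \<Longrightarrow> Y \<in> vfields A \<Longrightarrow> X - Y \<in> vfields A"
  by (auto simp: vfields_def vderiv_def intro!: tangent_space_diff smooth_funs_diff)

lemma vfields_scale: "f \<in> smooth_funs A \<Longrightarrow> X \<in> vfields A \<Longrightarrow> vscale f X \<in> vfields A"
  by (auto simp: vfields_def vderiv_def vscale_def tangent_space_scale)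
    (simp add: tscale_def smooth_funs_mult)

end

section \<open>The algebra of the nearly Kaehler curvature identity\<close>

text \<open>The carrier has no linear structure: that \<open>J\<close> squares to minus the identity
  is expressed through \<open>R_JJ\<close> and \<open>q_JJ\<close>, and polarized identities replace
  arguments with sums of fields. The geometric input is \<open>ricci\<close> and
  \<open>S_J\<close>.\<close>

locale nearly_kaehler_algebra =
  fixes F :: "'v set" and J :: "'v \<Rightarrow> 'v"
    and R S q :: "'v \<Rightarrow> 'v \<Rightarrow> 'v \<Rightarrow> 'v \<Rightarrow> real"
  assumes J: "X \<in> F \<Longrightarrow> J X \<in> F"
    and R_skew12: "\<lbrakk>X \<in> F; Y \<in> F; Z \<in> F; W \<in> F\<rbrakk> \<Longrightarrow> R Y X Z W = - R X Y Z W"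
    and R_skew34: "\<lbrakk>X \<in> F; Y \<in> F; Z \<in> F; W \<in> F\<rbrakk> \<Longrightarrow> R X Y W Z = - R X Y Z W"
    and R_pair: "\<lbrakk>X \<in> F; Y \<in> F; Z \<in> F; W \<in> F\<rbrakk> \<Longrightarrow> R Z W X Y = R X Y Z W"
    and R_bianchi: "\<lbrakk>X \<in> F; Y \<in> F; Z \<in> F; W \<in> F\<rbrakk> \<Longrightarrow> R X Y Z W + R Y Z X W + R Z X Y W = 0"
    and R_JJ: "\<lbrakk>X \<in> F; Y \<in> F; Z \<in> F; W \<in> F\<rbrakk> \<Longrightarrow> R (J (J X)) Y Z W = - R X Y Z W"
    and S_skew23: "\<lbrakk>X \<in> F; Y \<in> F; Z \<in> F; W \<in> F\<rbrakk> \<Longrightarrow> S X Z Y W = - S X Y Z W"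
    and S_skew34: "\<lbrakk>X \<in> F; Y \<in> F; Z \<in> F; W \<in> F\<rbrakk> \<Longrightarrow> S X Y W Z = - S X Y Z W"
    and q_skew: "\<lbrakk>X \<in> F; Y \<in> F; Z \<in> F; W \<in> F\<rbrakk> \<Longrightarrow> q Y X Z W = - q X Y Z W"
    and q_pair: "\<lbrakk>X \<in> F; Y \<in> F; Z \<in> F; W \<in> F\<rbrakk> \<Longrightarrow> q Z W X Y = q X Y Z W"
    and q_J: "\<lbrakk>X \<in> F; Y \<in> F; Z \<in> F; W \<in> F\<rbrakk> \<Longrightarrow> q X Y Z (J W) = q X Y (J Z) W"
    and q_J_skew: "\<lbrakk>X \<in> F; Y \<in> F; Z \<in> F; W \<in> F\<rbrakk> \<Longrightarrow> q X (J Y) Z W = - q X Y Z (J W)"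
    and q_JJ: "\<lbrakk>X \<in> F; Y \<in> F; Z \<in> F; W \<in> F\<rbrakk> \<Longrightarrow> q X Y Z (J (J W)) = - q X Y Z W"
    and ricci: "\<lbrakk>X \<in> F; Y \<in> F; Z \<in> F; W \<in> F\<rbrakk>
      \<Longrightarrow> S X Y Z W - S Y X Z W = R X Y (J Z) W + R X Y Z (J W)"
    and S_J: "\<lbrakk>X \<in> F; Y \<in> F; Z \<in> F; W \<in> F\<rbrakk>
      \<Longrightarrow> S X Y (J Z) W - S X Y Z (J W) = q Y W X Z + q Y Z X W"
begin

section \<open>Polarization and invariance of the curvature under \<open>J\<close>\<close>

definition L where "L X Y Z W = R X Y Z W - R X Y (J Z) (J W)"

lemma R_JJ4: "\<lbrakk>X \<in> F; Y \<in> F; Z \<in> F; W \<in> F\<rbrakk> \<Longrightarrow> R X Y Z (J (J W)) = - R X Y Z W"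
  by (metis J R_JJ R_pair R_skew12)

lemma R_JJ3: "\<lbrakk>X \<in> F; Y \<in> F; Z \<in> F; W \<in> F\<rbrakk> \<Longrightarrow> R X Y (J (J Z)) W = - R X Y Z W"
  by (metis J R_JJ R_pair)

lemma R_JJ2: "\<lbrakk>X \<in> F; Y \<in> F; Z \<in> F; W \<in> F\<rbrakk> \<Longrightarrow> R X (J (J Y)) Z W = - R X Y Z W"
  by (metis J R_JJ R_skew12)

lemma L_eq: "\<lbrakk>X \<in> F; Y \<in> F; Z \<in> F; W \<in> F\<rbrakk> \<Longrightarrow> L X Y Z W = S Y X Z (J W) - S X Y Z (J W)"
  using ricci[of X Y Z "J W"] R_JJ4[of X Y Z W] J by (simp add: L_def)

text \<open>Skewness in the last two slots turns \<open>S_J\<close> into a formula for the part of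
  \<open>S X Y Z (J W)\<close> that is symmetric in \<open>Z\<close> and \<open>W\<close>.\<close>

lemma S_J4:
  "\<lbrakk>X \<in> F; Y \<in> F; Z \<in> F; W \<in> F\<rbrakk>
    \<Longrightarrow> S X Y Z (J W) + S X Y W (J Z) = - q Y W X Z - q Y Z X W"
  using S_J[of X Y Z W] S_skew34[of X Y W "J Z"] J by simp

lemma q_skew34: "\<lbrakk>X \<in> F; Y \<in> F; Z \<in> F; W \<in> F\<rbrakk> \<Longrightarrow> q X Y W Z = - q X Y Z W"
  using q_pair q_skew by metis

text \<open>On the diagonal \<open>Z = X\<close>, \<open>W = Y\<close> this is
  \<open>L X Y X Y = - q X Y X Y\<close>: in \<open>L_eq\<close> the term
  \<open>S Y X X (J Y)\<close> vanishes by skewness and \<open>S_J4\<close> evaluates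
  \<open>S X Y X (J Y)\<close>.\<close>

lemma L_polar:
  assumes x: "X \<in> F" and y: "Y \<in> F" and z: "Z \<in> F" and w: "W \<in> F"
  shows "L X Y Z W + L Z Y X W + L X W Z Y + L Z W X Y
    = - (q X Y Z W + q Z Y X W + q X W Z Y + q Z W X Y)"
  using L_eq[OF x y z w] L_eq[OF z y x w] L_eq[OF x w z y] L_eq[OF z w x y]
    S_J4[OF x z y w] S_J4[OF z x y w]
    S_skew23[OF y x z J[OF w]] S_skew23[OF w x z J[OF y]]
    S_skew23[OF x y z J[OF w]] S_skew23[OF x w z J[OF y]]
    S_skew23[OF z y x J[OF w]] S_skew23[OF z w x J[OF y]]
    q_pair[OF x y z w] q_pair[OF x w z y] q_skew[OF y z x w] q_skew34[OF x w z y]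
    q_skew34[OF z y x w] q_skew34[OF z w x y] q_skew[OF z w x y] q_skew[OF x y z w]
    q_skew34[OF x y z w] q_skew[OF x w z y] q_skew[OF z y x w] q_skew34[OF w z x y]
    q_pair[OF z w x y] q_pair[OF z y x w] q_skew34[OF w x z y]
  by linarith

lemma R_J_J:
  assumes x: "X \<in> F" and y: "Y \<in> F" and z: "Z \<in> F" and w: "W \<in> F"
  shows "R (J X) (J Y) (J Z) (J W) = R X Y Z W"
proof -
  \<comment> \<open>\<open>M\<close> is an algebraic curvature tensor with \<open>M(X, Y, X, Y) = 0\<close>, polarized below.\<close>
  define M where "M X Y Z W = R X Y Z W - R (J X) (J Y) (J Z) (J W)" for X Y Z W
  \<comment> \<open>The bracket changes sign when the pairs \<open>X, Y\<close> and
    \<open>Z, W\<close> are exchanged, so it cancels in the symmetrized sum below.\<close>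
  have M_symm: "M X Y Z W = L X Y Z W + L (J X) (J Y) Z W
    + (R X Y (J Z) (J W) - R (J X) (J Y) Z W)" for X Y Z W
    by (simp add: M_def L_def)
  have L_JJ: "L (J X) (J Y) Z W = - L (J X) (J Y) (J Z) (J W)"
    if x: "X \<in> F" and y: "Y \<in> F" and z: "Z \<in> F" and w: "W \<in> F" for X Y Z W
    using that by (simp add: L_def J R_JJ3 R_JJ4)
  have q_JJ': "q (J X) (J Y) (J Z) (J W) = q X Y Z W"
    if x: "X \<in> F" and y: "Y \<in> F" and z: "Z \<in> F" and w: "W \<in> F" for X Y Z W
  proof -
    have "q X Y (J Z) (J W) = - q X Y Z W"
      if x: "X \<in> F" and y: "Y \<in> F" and z: "Z \<in> F" and w: "W \<in> F" for X Y Z W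
      using q_J[OF x y z J[OF w]] q_JJ[OF x y z w] that J by simp
    then show ?thesis using that J q_pair by (metis minus_minus)
  qed
  have polar: "M X Y Z W = - M Z Y X W"
    if x: "X \<in> F" and y: "Y \<in> F" and z: "Z \<in> F" and w: "W \<in> F" for X Y Z W
  proof -
    have pair: "M Z W X Y = M X Y Z W" "M Z Y X W = M X W Z Y"
      using that R_pair J by (simp_all add: M_def)
    \<comment> \<open>By \<open>L_polar\<close> the terms \<open>L X Y Z W\<close> add up to minus
      the \<open>q\<close>-sum; by \<open>L_JJ\<close> and \<open>q_JJ'\<close> the terms
      \<open>L (J X) (J Y) Z W\<close> add up to plus the same sum.\<close>
    have "M X Y Z W + M Z Y X W + M X W Z Y + M Z W X Y = 0"
      using L_polar[OF x y z w] L_polar[OF J[OF x] J[OF y] J[OF z] J[OF w]]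
      unfolding M_symm[of X Y Z W] M_symm[of Z Y X W] M_symm[of X W Z Y] M_symm[of Z W X Y]
      using L_JJ[OF x y z w] L_JJ[OF z y x w] L_JJ[OF x w z y] L_JJ[OF z w x y]
        q_JJ'[OF x y z w] q_JJ'[OF z y x w] q_JJ'[OF x w z y] q_JJ'[OF z w x y]
        R_pair[OF x y J[OF z] J[OF w]] R_pair[OF z w J[OF x] J[OF y]]
        R_pair[OF x w J[OF z] J[OF y]] R_pair[OF z y J[OF x] J[OF w]] by linarith
    then show ?thesis using pair by simp
  qed
  have "M X Y Z W + M Y Z X W + M Z X Y W = 0"
    using R_bianchi[OF x y z w] R_bianchi[OF J[OF x] J[OF y] J[OF z] J[OF w]] assms J
    by (simp add: M_def)
  moreover have "M Y X Z W = - M X Y Z W" "M X Z Y W = - M Z X Y W"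
    using assms J R_skew12[OF x y z w] R_skew12[OF J[OF x] J[OF y] J[OF z] J[OF w]]
      R_skew12[OF z x y w] R_skew12[OF J[OF z] J[OF x] J[OF y] J[OF w]] by (simp_all add: M_def)
  \<comment> \<open>Being skew under exchange of slots 1, 2 and of slots 1, 3, \<open>M\<close> is
    invariant under cyclic shifts of its first three slots, so Bianchi says that three times
    \<open>M\<close> is 0.\<close>
  ultimately have "M X Y Z W = 0"
    using polar[OF z x y w] polar[OF x y z w] polar[OF y x z w] polar[OF y z x w] by linarith
  then show ?thesis by (simp add: M_def)
qed

lemma R_J_pair:
  assumes x: "X \<in> F" and y: "Y \<in> F" and z: "Z \<in> F" and w: "W \<in> F"
  shows "R (J X) (J Y) Z W = R X Y (J Z) (J W)"
  using R_J_J[OF J[OF x] J[OF y] z w] assms J by (simp add: R_JJ R_JJ2)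

lemma L_pair:
  assumes x: "X \<in> F" and y: "Y \<in> F" and z: "Z \<in> F" and w: "W \<in> F"
  shows "L Z W X Y = L X Y Z W"
  using R_J_pair[OF x y z w] R_pair[OF x y z w] R_pair[OF J[OF x] J[OF y] z w] assms J
  by (simp add: L_def)

section \<open>The 4-form \<open>d\<close>\<close>

definition d where "d X Y Z W = L X Y Z W + q X Y Z W"

lemma d_skew12:
  assumes x: "X \<in> F" and y: "Y \<in> F" and z: "Z \<in> F" and w: "W \<in> F"
  shows "d Y X Z W = - d X Y Z W"
  using assms J R_skew12[OF x y z w] R_skew12[OF x y J[OF z] J[OF w]] q_skew[OF x y z w]
  by (simp add: d_def L_def)

lemma d_pair:
  assumes x: "X \<in> F" and y: "Y \<in> F" and z: "Z \<in> F" and w: "W \<in> F"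
  shows "d Z W X Y = d X Y Z W"
  using L_pair[OF assms] q_pair[OF assms] by (simp add: d_def)

lemma d_skew34:
  assumes x: "X \<in> F" and y: "Y \<in> F" and z: "Z \<in> F" and w: "W \<in> F"
  shows "d X Y W Z = - d X Y Z W"
  using assms d_pair d_skew12 by metis

text \<open>Pair symmetry makes the four terms of \<open>L_polar\<close> agree in twos. Together
  with \<open>d_skew12\<close> and \<open>d_skew34\<close> this makes \<open>d\<close> totally
  skew.\<close>

lemma d_skew13:
  assumes x: "X \<in> F" and y: "Y \<in> F" and z: "Z \<in> F" and w: "W \<in> F"
  shows "d Z Y X W = - d X Y Z W"
  using L_polar[OF assms] d_pair[OF x y z w] d_pair[OF x w z y] unfolding d_def by linarith

lemma d_cyclic:
  assumes x: "X \<in> F" and y: "Y \<in> F" and z: "Z \<in> F" and w: "W \<in> F"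
  shows "d Y Z X W = d X Y Z W"
  using d_skew13[OF x z y w] d_skew12[OF x y z w] d_skew13[OF y x z w] d_skew12[OF x z y w]
    d_skew12[OF z x y w] d_skew13[OF x y z w] d_skew12[OF z y x w] d_skew13[OF z x y w]
  by linarith

text \<open>Both \<open>L\<close> and \<open>q\<close> change sign when \<open>J\<close> is applied
  to slots 3 and 4; skewness of \<open>d\<close> carries this over to slots 1 and 4.\<close>

lemma d_J:
  assumes x: "X \<in> F" and y: "Y \<in> F" and z: "Z \<in> F" and w: "W \<in> F"
  shows "d (J X) Y Z W = d X Y Z (J W)"
proof -
  have *: "d X Y (J Z) (J W) = - d X Y Z W"
    if x: "X \<in> F" and y: "Y \<in> F" and z: "Z \<in> F" and w: "W \<in> F" for X Y Z W
    using q_J[OF x y z J[OF w]] q_JJ[OF x y z w] that J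
    by (simp add: d_def L_def R_JJ3 R_JJ4)
  have "d (J X) Y Z W = - d Z Y (J X) W" using d_skew13 assms J by metis
  also have "\<dots> = d Z Y (J X) (J (J W))"
    using assms J q_JJ[OF z y J[OF x] w] by (simp add: d_def L_def R_JJ4)
  also have "\<dots> = - d Z Y X (J W)" using * assms J by metis
  also have "\<dots> = d X Y Z (J W)" using d_skew13[OF x y z J[OF w]] assms J by simp
  finally show ?thesis .
qed

section \<open>Closedness of \<open>\<tau>\<close> and vanishing of \<open>d\<close>\<close>

lemma S_rotate:
  assumes x: "X \<in> F" and y: "Y \<in> F" and z: "Z \<in> F" and w: "W \<in> F"
  shows "S X Z W Y = S X Y Z W"
  using S_skew23[OF x y z w] S_skew34[OF x z y w] by linarith

text \<open>In the sum of three Ricci identities each \<open>S\<close>-term occurs twice by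
  skewness, and the curvature terms with \<open>J W\<close> cancel by Bianchi.\<close>

lemma S_cyclic:
  assumes x: "X \<in> F" and y: "Y \<in> F" and z: "Z \<in> F" and w: "W \<in> F"
  shows "2 * (S X Y Z W + S Y Z X W + S Z X Y W) = R X Y (J Z) W + R Y Z (J X) W + R Z X (J Y) W"
  using ricci[OF x y z w] ricci[OF y z x w] ricci[OF z x y w] R_bianchi[OF x y z J[OF w]]
    S_skew23[OF x y z w] S_skew23[OF y x z w] S_skew23[OF z x y w]
  unfolding distrib_left by linarith

text \<open>This is \<open>d\<tau> = 0\<close>; it follows from the Ricci and Bianchi identities alone.\<close>

lemma S_closed:
  assumes x: "X \<in> F" and y: "Y \<in> F" and z: "Z \<in> F" and w: "W \<in> F"
  shows "S X Y Z W + S Y Z X W + S Z X Y W = S W X Y Z"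
  using S_cyclic[OF x y z w] S_cyclic[OF y z w x] S_cyclic[OF z w x y] S_cyclic[OF w x y z]
    S_rotate[OF y x z w] S_skew23[OF y x z w] S_rotate[OF z x w y] S_skew34[OF z x y w]
    S_rotate[OF w x y z] S_rotate[OF z x y w] S_rotate[OF z y w x] S_skew34[OF w x y z]
    S_rotate[OF x y z w] S_skew34[OF x y z w] S_rotate[OF y z w x]
    R_bianchi[OF x y w J[OF z]] R_bianchi[OF x y z J[OF w]]
    R_bianchi[OF x z w J[OF y]] R_bianchi[OF y z w J[OF x]]
    R_skew34[OF x y J[OF z] w] R_skew34[OF y w J[OF z] x] R_skew34[OF w x J[OF z] y]
    R_skew34[OF x y J[OF w] z] R_skew34[OF y z J[OF w] x] R_skew34[OF z x J[OF w] y]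
    R_skew34[OF x z J[OF y] w] R_skew34[OF z w J[OF y] x] R_skew34[OF w x J[OF y] z]
    R_skew34[OF y z J[OF x] w] R_skew34[OF z w J[OF x] y] R_skew34[OF w y J[OF x] z]
    R_skew12[OF z x J[OF y] w] R_skew12[OF w y J[OF z] x] R_skew12[OF z x J[OF w] y]
    R_skew12[OF w y J[OF x] z]
  unfolding distrib_left by linarith

text \<open>Closedness reduces the cyclic sum to one term. Each \<open>R X Y (J Z) W\<close> is
  \<open>d - q - R\<close> at \<open>X Y Z (J W)\<close>; summed cyclically, \<open>R\<close> drops
  out by Bianchi and the three values of \<open>d\<close> are equal.\<close>

lemma S_eq_d:
  assumes x: "X \<in> F" and y: "Y \<in> F" and z: "Z \<in> F" and w: "W \<in> F"
  shows "2 * S W X Y Z = 3 * d X Y Z (J W) - (q X Y Z (J W) + q Y Z X (J W) + q Z X Y (J W))"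
proof -
  have "2 * S W X Y Z = R X Y (J Z) W + R Y Z (J X) W + R Z X (J Y) W"
    using S_cyclic[OF assms] S_closed[OF assms] by simp
  moreover have "R X Y (J Z) W = d X Y Z (J W) - q X Y Z (J W) - R X Y Z (J W)"
    if "X \<in> F" "Y \<in> F" "Z \<in> F" for X Y Z
    using that assms(4) J by (simp add: d_def L_def R_JJ4)
  ultimately show ?thesis
    using R_bianchi[OF x y z J[OF w]] d_cyclic[OF x y z J[OF w]] d_cyclic[OF y z x J[OF w]] x y z
    by simp
qed

lemma d_rotate:
  assumes x: "X \<in> F" and y: "Y \<in> F" and z: "Z \<in> F" and w: "W \<in> F"
  shows "d Y Z W X = - d X Y Z W"
  using d_skew34[OF y z x w] d_skew13[OF x z y w] d_skew12[OF z x y w] d_skew13[OF y x z w]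
    d_skew12[OF x y z w] by linarith

text \<open>Put \<open>S_eq_d\<close> into twice \<open>S_closed\<close>: the left side contributes
  \<open>- 9\<close> and the right side \<open>3\<close> times \<open>d X Y Z (J W)\<close>, while
  the \<open>q\<close>-sums on both sides agree.\<close>

lemma d_zero:
  assumes x: "X \<in> F" and y: "Y \<in> F" and z: "Z \<in> F" and w: "W \<in> F"
  shows "d X Y Z (J W) = 0"
proof -
  have q_sign: "q X Y W (J Z) = - q X Y Z (J W)" "q Z W Y (J X) = q X Y Z (J W)"
    "q W Z X (J Y) = q X Y Z (J W)"
    if x: "X \<in> F" and y: "Y \<in> F" and z: "Z \<in> F" for X Y Z
  proof -
    show 1: "q X Y W (J Z) = - q X Y Z (J W)"
      using q_J[OF x y z w] q_skew34[OF x y J[OF z] w] by linarith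
    have 2: "q Z W X (J Y) = - q X Y Z (J W)"
      using q_pair[OF x J[OF y] z w] q_J_skew[OF x y z w] by linarith
    show "q Z W Y (J X) = q X Y Z (J W)"
      using 2 q_J[OF z w x y] q_skew34[OF z w J[OF x] y] by linarith
    show "q W Z X (J Y) = q X Y Z (J W)"
      using 2 q_skew[OF z w x J[OF y]] by linarith
  qed
  have d_move: "d Y Z W (J X) = - d X Y Z (J W)"
    if x: "X \<in> F" and y: "Y \<in> F" and z: "Z \<in> F" for X Y Z
    using d_rotate[OF J[OF x] y z w] d_J[OF x y z w] by linarith
  show ?thesis
    using S_closed[OF x y z w] S_eq_d[OF x y z w] S_eq_d[OF y z w x] S_eq_d[OF z x w y]
      S_eq_d[OF x y w z] d_move[OF x y z] d_move[OF y z x] d_move[OF z x y]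
      d_cyclic[OF x y z J[OF w]] d_cyclic[OF y z x J[OF w]]
      q_sign[OF x y z] q_sign[OF y z x] q_sign[OF z x y]
    by linarith
qed

lemma curvature_identity:
  assumes x: "X \<in> F" and y: "Y \<in> F" and z: "Z \<in> F" and w: "W \<in> F"
  shows "R X Y Z W - R X Y (J Z) (J W) = - q X Y Z W"
proof -
  have "d X Y Z (J (J W)) = - d X Y Z W"
    using assms J by (simp add: d_def L_def R_JJ4 q_JJ)
  then show ?thesis using d_zero[OF x y z J[OF w]] assms J by (simp add: d_def L_def)
qed

end

section \<open>The Levi-Civita connection\<close>

lemma vscale_zero [simp]: "vscale (\<lambda>p. 0) X = 0" "vscale f 0 = 0"
  by (intro ext, simp add: vscale_def tscale_def)+

locale levi_civita_manifold =
  fixes A :: "('m::{t2_space, second_countable_topology}, 'e::euclidean_space) atlas"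
    and g :: "'m \<Rightarrow> 'm tangent \<Rightarrow> 'm tangent \<Rightarrow> real"
    and D :: "'m vfield \<Rightarrow> 'm vfield \<Rightarrow> 'm vfield"
  assumes atlas: "smooth_atlas A"
    and metric: "riemannian_metric A g"
    and levi_civita: "levi_civita_connection A g D"
begin

abbreviation V where "V \<equiv> vfields A"
abbreviation C where "C \<equiv> smooth_funs A"

section \<open>The metric on vector fields\<close>

definition ip where "ip X Y = (\<lambda>p. g p (X p) (Y p))"

lemmas smooth_closed [simp, intro] =
  smooth_funs_add[OF atlas] smooth_funs_mult[OF atlas] smooth_funs_const[OF atlas] smooth_funs_diff[OF atlas]
  vfields_add[OF atlas] vfields_diff[OF atlas] vfields_scale[OF atlas]

lemma vderiv_smooth [simp]: "X \<in> V \<Longrightarrow> f \<in> C \<Longrightarrow> vderiv X f \<in> C"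
  by (simp add: vfields_def)

lemma tangent [simp]: "X \<in> V \<Longrightarrow> X p \<in> tangent_space A p"
  unfolding vfields_def by blast

lemma g_linear:
  "\<lbrakk>u \<in> tangent_space A p; v \<in> tangent_space A p; w \<in> tangent_space A p\<rbrakk>
    \<Longrightarrow> g p (tscale a u + tscale b v) w = a * g p u w + b * g p v w"
  using metric by (simp add: riemannian_metric_def)

lemma ip_linear:
  "\<lbrakk>X \<in> V; Y \<in> V; Z \<in> V\<rbrakk>
    \<Longrightarrow> g p (tscale a (X p) + tscale b (Y p)) (Z p) = a * ip X Z p + b * ip Y Z p"
  by (simp add: g_linear ip_def)

lemma ip_smooth [simp]: "X \<in> V \<Longrightarrow> Y \<in> V \<Longrightarrow> ip X Y \<in> C"
  using metric by (simp add: riemannian_metric_def ip_def)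

lemma ip_commute: "X \<in> V \<Longrightarrow> Y \<in> V \<Longrightarrow> ip X Y p = ip Y X p"
  using metric by (simp add: riemannian_metric_def ip_def)

text \<open>These instances split the single linearity clauses for \<open>g\<close> and
  \<open>\<theta>\<close> into rules for sums, differences and multiples.\<close>

lemma tscale_combine [simp]:
  "tscale 1 u + tscale 1 v = u + v" "tscale 1 u + tscale (- 1) v = u - v"
  "tscale 0 u + tscale 1 v = v" "tscale c u + tscale 0 v = tscale c u"
  by (auto simp: tscale_def)

lemma ip_add_left [simp]: "\<lbrakk>X \<in> V; Y \<in> V; Z \<in> V\<rbrakk> \<Longrightarrow> ip (X + Y) Z p = ip X Z p + ip Y Z p"
  using ip_linear[of X Y Z p 1 1] by (simp add: ip_def)

lemma ip_diff_left [simp]: "\<lbrakk>X \<in> V; Y \<in> V; Z \<in> V\<rbrakk> \<Longrightarrow> ip (X - Y) Z p = ip X Z p - ip Y Z p"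
  using ip_linear[of X Y Z p 1 "- 1"] by (simp add: ip_def)

lemma ip_scale_left [simp]: "\<lbrakk>f \<in> C; X \<in> V; Y \<in> V\<rbrakk> \<Longrightarrow> ip (vscale f X) Y p = f p * ip X Y p"
  using ip_linear[of X X Y p "f p" 0] by (simp add: ip_def vscale_def)

lemma ip_add_right [simp]: "\<lbrakk>X \<in> V; Y \<in> V; Z \<in> V\<rbrakk> \<Longrightarrow> ip X (Y + Z) p = ip X Y p + ip X Z p"
  using ip_add_left[of Y Z X] ip_commute[of X] by simp

lemma ip_diff_right [simp]: "\<lbrakk>X \<in> V; Y \<in> V; Z \<in> V\<rbrakk> \<Longrightarrow> ip X (Y - Z) p = ip X Y p - ip X Z p"
  using ip_diff_left[of Y Z X] ip_commute[of X] by simp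

lemma ip_scale_right [simp]: "\<lbrakk>f \<in> C; X \<in> V; Y \<in> V\<rbrakk> \<Longrightarrow> ip X (vscale f Y) p = f p * ip X Y p"
  using ip_scale_left[of f Y X] ip_commute[of X] by simp

lemma vfields_zero [simp]: "0 \<in> V"
  using smooth_funs_const[OF atlas] by (simp add: vfields_def vderiv_def tangent_space_def del: tangent)

lemma ip_zero [simp]: "X \<in> V \<Longrightarrow> ip 0 X p = 0" "X \<in> V \<Longrightarrow> ip X 0 p = 0"
  using ip_diff_left[of 0 0 X] ip_diff_right[of X 0 0] by simp_all

lemma vfields_uminus [simp]: "X \<in> V \<Longrightarrow> - X \<in> V"
  using vfields_diff[OF atlas vfields_zero, of X] by simp

lemma ip_uminus [simp]:
  assumes "X \<in> V" "Y \<in> V"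
  shows "ip (- X) Y p = - ip X Y p" "ip X (- Y) p = - ip X Y p"
  using ip_diff_left[of 0 X Y p] ip_diff_right[of X 0 Y p] assms by simp_all

lemma ip_definite:
  assumes "X \<in> V" "\<And>p. ip X X p = 0"
  shows "X = 0"
proof
  fix p
  have "v \<noteq> 0 \<Longrightarrow> 0 < g p v v" if "v \<in> tangent_space A p" for v
    using metric that by (simp add: riemannian_metric_def)
  then show "X p = 0 p"
    using assms(2)[of p] tangent[OF assms(1), of p] by (fastforce simp: ip_def)
qed

section \<open>Vector fields as derivations\<close>

lemma vderiv_linear:
  "\<lbrakk>X \<in> V; f \<in> C; h \<in> C\<rbrakk>
    \<Longrightarrow> vderiv X (\<lambda>p. a * f p + b * h p) p = a * vderiv X f p + b * vderiv X h p"
  using tangent[of X p] by (simp add: tangent_space_def vderiv_def)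

lemma vderiv_add [simp]:
  "\<lbrakk>X \<in> V; f \<in> C; h \<in> C\<rbrakk> \<Longrightarrow> vderiv X (\<lambda>p. f p + h p) p = vderiv X f p + vderiv X h p"
  using vderiv_linear[of X f h 1 1] by simp

lemma vderiv_diff [simp]:
  "\<lbrakk>X \<in> V; f \<in> C; h \<in> C\<rbrakk> \<Longrightarrow> vderiv X (\<lambda>p. f p - h p) p = vderiv X f p - vderiv X h p"
  using vderiv_linear[of X f h 1 "- 1"] by simp

lemma vderiv_uminus [simp]: "\<lbrakk>X \<in> V; f \<in> C\<rbrakk> \<Longrightarrow> vderiv X (\<lambda>p. - f p) p = - vderiv X f p"
  using vderiv_linear[of X f f "- 1" 0] by simp

lemma vderiv_const [simp]:
  assumes "X \<in> V"
  shows "vderiv X (\<lambda>q. c) p = 0"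
proof -
  have "\<forall>f\<in>C. \<forall>h\<in>C. X p (\<lambda>q. f q * h q) = f p * X p h + h p * X p f"
    using tangent[OF assms, of p] by (simp add: tangent_space_def)
  \<comment> \<open>The Leibniz rule for \<open>1 * 1 = 1\<close> says that the derivative of 1
    equals its own double.\<close>
  from this[rule_format, of "\<lambda>q. 1" "\<lambda>q. 1"] have "vderiv X (\<lambda>q. 1) p = 0"
    by (simp add: vderiv_def)
  then show ?thesis using vderiv_linear[of X "\<lambda>q. 1" "\<lambda>q. 1" c 0] assms by simp
qed

section \<open>Covariant derivative and Lie bracket\<close>

lemma D_closed [simp]: "X \<in> V \<Longrightarrow> Y \<in> V \<Longrightarrow> D X Y \<in> V"
  using levi_civita by (simp add: levi_civita_connection_def affine_connection_def)

lemma D_add [simp]: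
  assumes "X \<in> V" "Y \<in> V" "Z \<in> V"
  shows "D (X + Y) Z = D X Z + D Y Z" "D X (Y + Z) = D X Y + D X Z"
  using levi_civita assms by (simp_all add: levi_civita_connection_def affine_connection_def)

lemma D_diff [simp]:
  assumes "X \<in> V" "Y \<in> V" "Z \<in> V"
  shows "D (X - Y) Z = D X Z - D Y Z" "D X (Y - Z) = D X Y - D X Z"
  using D_add(1)[of "X - Y" Y Z] D_add(2)[of X "Y - Z" Z] assms by (simp_all add: eq_diff_eq)

lemma D_zero [simp]: "X \<in> V \<Longrightarrow> D X 0 = 0"
  using D_diff(2)[of X 0 0] by simp

lemma D_scale [simp]:
  assumes "f \<in> C" "X \<in> V" "Y \<in> V"
  shows "D (vscale f X) Y = vscale f (D X Y)"
    "D X (vscale f Y) = vscale (vderiv X f) Y + vscale f (D X Y)"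
  using levi_civita assms by (simp_all add: levi_civita_connection_def affine_connection_def)

lemma vderiv_ip:
  "\<lbrakk>X \<in> V; Y \<in> V; Z \<in> V\<rbrakk> \<Longrightarrow> vderiv X (ip Y Z) p = ip (D X Y) Z p + ip Y (D X Z) p"
  using levi_civita by (simp add: levi_civita_connection_def ip_def)

lemma lie_bracket_eq: "X \<in> V \<Longrightarrow> Y \<in> V \<Longrightarrow> lie_bracket A X Y = D X Y - D Y X"
  using levi_civita by (simp add: levi_civita_connection_def)

lemma vderiv_lie_bracket:
  "f \<in> C \<Longrightarrow> vderiv (lie_bracket A X Y) f p = vderiv X (vderiv Y f) p - vderiv Y (vderiv X f) p"
  by (simp add: vderiv_def lie_bracket_def)

lemma jacobi:
  assumes "X \<in> V" "Y \<in> V" "Z \<in> V"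
  shows "lie_bracket A X (lie_bracket A Y Z) + lie_bracket A Y (lie_bracket A Z X)
    + lie_bracket A Z (lie_bracket A X Y) = 0"
proof (intro ext)
  fix p f
  have "lie_bracket A X (lie_bracket A Y Z) p f = vderiv X (vderiv Y (vderiv Z f)) p
      - vderiv X (vderiv Z (vderiv Y f)) p - vderiv Y (vderiv Z (vderiv X f)) p
      + vderiv Z (vderiv Y (vderiv X f)) p"
    if "X \<in> V" "Y \<in> V" "Z \<in> V" "f \<in> C" for X Y Z
  proof -
    have "vderiv (lie_bracket A Y Z) f = (\<lambda>p. vderiv Y (vderiv Z f) p - vderiv Z (vderiv Y f) p)"
      using that by (intro ext) (simp add: vderiv_lie_bracket)
    then have "vderiv X (vderiv (lie_bracket A Y Z) f) p
        = vderiv X (vderiv Y (vderiv Z f)) p - vderiv X (vderiv Z (vderiv Y f)) p"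
      using that by simp
    then show ?thesis using that vderiv_lie_bracket[of f X "lie_bracket A Y Z" p]
        vderiv_lie_bracket[of "vderiv X f" Y Z p] by (simp add: vderiv_def[of "lie_bracket A X _"])
  qed
  \<comment> \<open>For smooth \<open>f\<close> the twelve third-order terms cancel in pairs; for
    other \<open>f\<close> every bracket is 0 by definition.\<close>
  then show "(lie_bracket A X (lie_bracket A Y Z) + lie_bracket A Y (lie_bracket A Z X)
    + lie_bracket A Z (lie_bracket A X Y)) p f = 0 p f"
    using assms by (cases "f \<in> C") (simp_all, simp add: lie_bracket_def)
qed

section \<open>Symmetries of the curvature\<close>

lemma curvature_eq:
  assumes "X \<in> V" "Y \<in> V" "Z \<in> V" "W \<in> V"
  shows "curvature A g D X Y Z W p = ip (D X (D Y Z)) W p - ip (D Y (D X Z)) W p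
    - (ip (D (D X Y) Z) W p - ip (D (D Y X) Z) W p)"
proof -
  have "curvature A g D X Y Z W p = ip (curvature_op A D X Y Z) W p"
    by (simp add: curvature_def ip_def)
  then show ?thesis using assms by (simp add: curvature_op_def lie_bracket_eq)
qed

lemma curvature_skew12:
  "\<lbrakk>X \<in> V; Y \<in> V; Z \<in> V; W \<in> V\<rbrakk> \<Longrightarrow> curvature A g D Y X Z W p = - curvature A g D X Y Z W p"
  by (simp add: curvature_eq)

lemma vderiv_vderiv_ip:
  assumes "X \<in> V" "Y \<in> V" "Z \<in> V" "W \<in> V"
  shows "vderiv X (vderiv Y (ip Z W)) p = ip (D X (D Y Z)) W p + ip (D Y Z) (D X W) p
    + (ip (D X Z) (D Y W) p + ip Z (D X (D Y W)) p)"
proof -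
  have "vderiv Y (ip Z W) = (\<lambda>p. ip (D Y Z) W p + ip Z (D Y W) p)"
    using assms by (intro ext) (simp add: vderiv_ip)
  then show ?thesis using assms by (simp add: vderiv_ip)
qed

text \<open>The bracket acts on the function \<open>ip Z W\<close> as the commutator of
  \<open>X\<close> and \<open>Y\<close>; metric compatibility expands both sides, and the mixed
  terms cancel.\<close>

lemma curvature_skew34:
  assumes "X \<in> V" "Y \<in> V" "Z \<in> V" "W \<in> V"
  shows "curvature A g D X Y W Z p = - curvature A g D X Y Z W p"
proof -
  have "vderiv (D X Y - D Y X) (ip Z W) p
      = vderiv X (vderiv Y (ip Z W)) p - vderiv Y (vderiv X (ip Z W)) p"
    using vderiv_lie_bracket[of "ip Z W" X Y p] assms by (simp add: lie_bracket_eq)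
  then show ?thesis using assms
    by (simp add: curvature_eq vderiv_vderiv_ip vderiv_ip ip_commute[of Z])
qed

text \<open>With brackets written through \<open>D\<close>, the cyclic sum is the Jacobi identity
  paired with \<open>W\<close>.\<close>

lemma curvature_bianchi:
  assumes "X \<in> V" "Y \<in> V" "Z \<in> V" "W \<in> V"
  shows "curvature A g D X Y Z W p + curvature A g D Y Z X W p + curvature A g D Z X Y W p = 0"
proof -
  have "ip (lie_bracket A X (lie_bracket A Y Z) + lie_bracket A Y (lie_bracket A Z X)
    + lie_bracket A Z (lie_bracket A X Y)) W p = 0"
    unfolding jacobi[OF assms(1-3)] using assms by simp
  then show ?thesis using assms by (simp add: lie_bracket_eq curvature_eq)
qed

text \<open>The classical octahedron argument: combine the four Bianchi identities that keep the
  cyclic order of the arguments.\<close>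

lemma curvature_pair:
  assumes "X \<in> V" "Y \<in> V" "Z \<in> V" "W \<in> V"
  shows "curvature A g D Z W X Y p = curvature A g D X Y Z W p"
  using curvature_bianchi[of X Y Z W p] curvature_bianchi[of Y Z W X p]
    curvature_bianchi[of Z W X Y p] curvature_bianchi[of W X Y Z p]
    curvature_skew34[of X Y Z W p] curvature_skew34[of Y Z X W p] curvature_skew34[of Z X Y W p]
    curvature_skew34[of Z W X Y p] curvature_skew34[of W Y X Z p] curvature_skew34[of W X Y Z p]
    curvature_skew12[of X Z Y W p] curvature_skew12[of Y W X Z p]
    curvature_skew12[of X Z W Y p] curvature_skew12[of Y W Z X p] assms
  by simp

text \<open>The derivatives of \<open>f\<close> arising from \<open>D Y (D (vscale f U) Z)\<close>
  and \<open>D (D Y (vscale f U)) Z\<close> cancel. The difference has the shape of the projection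
  \<open>hor\<close> below.\<close>

lemma curvature_tensor:
  assumes "f \<in> C" "X \<in> V" "U \<in> V" "Y \<in> V" "Z \<in> V" "W \<in> V"
  shows "curvature A g D (X - vscale f U) Y Z W p
    = curvature A g D X Y Z W p - f p * curvature A g D U Y Z W p"
  using assms by (simp add: curvature_eq algebra_simps)

end

section \<open>Nearly cosymplectic manifolds\<close>

locale nearly_cosymplectic_manifold = levi_civita_manifold A g D
  for A :: "('m::{t2_space, second_countable_topology}, 'e::euclidean_space) atlas"
    and g :: "'m \<Rightarrow> 'm tangent \<Rightarrow> 'm tangent \<Rightarrow> real"
    and D :: "'m vfield \<Rightarrow> 'm vfield \<Rightarrow> 'm vfield" +
  fixes \<theta> :: "'m \<Rightarrow> 'm tangent \<Rightarrow> 'm tangent"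
    and \<xi> :: "'m vfield"
    and \<eta> :: "'m \<Rightarrow> 'm tangent \<Rightarrow> real"
  assumes nearly_cosymplectic: "nearly_cosymplectic A g D \<theta> \<xi> \<eta>"
begin

abbreviation J where "J \<equiv> endo_app \<theta>"
abbreviation T where "T \<equiv> cov_deriv_endo D \<theta>"

section \<open>The almost contact structure\<close>

lemma almost_contact: "almost_contact_metric A g \<theta> \<xi> \<eta>"
  using nearly_cosymplectic by (simp add: nearly_cosymplectic_def)

lemma J_closed [simp]: "X \<in> V \<Longrightarrow> J X \<in> V"
  using almost_contact by (simp add: almost_contact_metric_def tensor_field_1_1_def)

lemma xi_closed [simp]: "\<xi> \<in> V"
  using almost_contact by (simp add: almost_contact_metric_def)

lemma ip_xi_xi [simp]: "ip \<xi> \<xi> p = 1"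
  using almost_contact by (simp add: almost_contact_metric_def ip_def)

lemma J_linear:
  "\<lbrakk>X \<in> V; Y \<in> V\<rbrakk> \<Longrightarrow> \<theta> p (tscale a (X p) + tscale b (Y p)) = tscale a (J X p) + tscale b (J Y p)"
  using almost_contact tangent[of X p] tangent[of Y p]
  unfolding almost_contact_metric_def tensor_field_1_1_def by (auto simp: endo_app_def)

lemma J_diff [simp]: "\<lbrakk>X \<in> V; Y \<in> V\<rbrakk> \<Longrightarrow> J (X - Y) = J X - J Y"
  using J_linear[of X Y _ 1 "- 1"] by (intro ext) (simp add: endo_app_def)

lemma J_add [simp]: "\<lbrakk>X \<in> V; Y \<in> V\<rbrakk> \<Longrightarrow> J (X + Y) = J X + J Y"
  using J_linear[of X Y _ 1 1] by (intro ext) (simp add: endo_app_def)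

lemma J_scale [simp]: "X \<in> V \<Longrightarrow> J (vscale f X) = vscale f (J X)"
  using J_linear[of X X _ "f _" 0] by (intro ext) (simp add: endo_app_def vscale_def)

lemma J_uminus [simp]: "X \<in> V \<Longrightarrow> J (- X) = - J X"
  using J_diff[of "X - X" X] J_diff[of X X] by simp

text \<open>Compatibility with the metric gives \<open>J \<xi>\<close> the squared length 1 -
  1.\<close>

lemma J_xi [simp]: "J \<xi> = 0"
proof (rule ip_definite)
  show "ip (J \<xi>) (J \<xi>) p = 0" for p
    using almost_contact tangent[OF xi_closed, of p]
    by (simp add: almost_contact_metric_def ip_def endo_app_def)
qed simp

lemma eta_eq: "X \<in> V \<Longrightarrow> \<eta> p (X p) = ip X \<xi> p"
proof -
  assume X: "X \<in> V"
  have "ip (J X) (J \<xi>) p = ip X \<xi> p - \<eta> p (X p) * \<eta> p (\<xi> p)" "\<eta> p (\<xi> p) = 1"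
    using almost_contact tangent[OF xi_closed, of p] tangent[OF X, of p]
    by (auto simp: almost_contact_metric_def ip_def endo_app_def)
  then show ?thesis using X by simp
qed

lemma J_J: "X \<in> V \<Longrightarrow> J (J X) = vscale (ip X \<xi>) \<xi> - X"
proof
  fix p
  assume X: "X \<in> V"
  have "J (J X) p = - X p + tscale (\<eta> p (X p)) (\<xi> p)"
    using almost_contact tangent[OF X, of p] by (simp add: almost_contact_metric_def endo_app_def)
  then show "J (J X) p = (vscale (ip X \<xi>) \<xi> - X) p"
    using eta_eq[OF X] by (simp add: vscale_def)
qed

lemma ip_J_J: "\<lbrakk>X \<in> V; Y \<in> V\<rbrakk> \<Longrightarrow> ip (J X) (J Y) p = ip X Y p - ip X \<xi> p * ip Y \<xi> p"
proof -
  assume X: "X \<in> V" and Y: "Y \<in> V"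
  have "ip (J X) (J Y) p = ip X Y p - \<eta> p (X p) * \<eta> p (Y p)"
    using almost_contact tangent[OF X, of p] tangent[OF Y, of p]
    by (simp add: almost_contact_metric_def endo_app_def ip_def)
  then show ?thesis using eta_eq X Y by simp
qed

text \<open>Computing \<open>J (J (J X))\<close> as \<open>J\<close> of \<open>J (J X)\<close> and
  by \<open>J_J\<close> at \<open>J X\<close> gives results that differ by the
  \<open>\<xi>\<close>-component of \<open>J X\<close>.\<close>

lemma ip_J_xi [simp]: "X \<in> V \<Longrightarrow> ip (J X) \<xi> p = 0" "X \<in> V \<Longrightarrow> ip \<xi> (J X) p = 0"
proof -
  assume X: "X \<in> V"
  have "J (J (J X)) = - J X" using J_J[OF X] X by simp
  then have "vscale (ip (J X) \<xi>) \<xi> = 0" using J_J[of "J X"] X by simp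
  then have "ip (vscale (ip (J X) \<xi>) \<xi>) \<xi> p = 0" using X by simp
  then show "ip (J X) \<xi> p = 0" using X by simp
  then show "ip \<xi> (J X) p = 0" using X ip_commute by simp
qed

lemma J_skew: "\<lbrakk>X \<in> V; Y \<in> V\<rbrakk> \<Longrightarrow> ip (J X) Y p = - ip X (J Y) p"
  using ip_J_J[of X "J Y" p] by (simp add: J_J)

section \<open>The derivative of \<open>\<theta>\<close> and the Killing field
  \<open>\<xi>\<close>\<close>

lemma T_closed [simp]: "\<lbrakk>X \<in> V; Y \<in> V\<rbrakk> \<Longrightarrow> T X Y \<in> V"
  by (simp add: cov_deriv_endo_def)

lemma T_skew: "\<lbrakk>X \<in> V; Y \<in> V\<rbrakk> \<Longrightarrow> T Y X = - T X Y"
  using nearly_cosymplectic by (simp add: nearly_cosymplectic_def eq_neg_iff_add_eq_0)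

lemma vderiv_J_skew:
  assumes "X \<in> V" "Y \<in> V" "Z \<in> V"
  shows "vderiv X (ip (J Y) Z) p = - vderiv X (ip Y (J Z)) p"
proof -
  have "ip (J Y) Z = (\<lambda>p. - ip Y (J Z) p)" using assms J_skew by (intro ext) simp
  then show ?thesis using assms by simp
qed

text \<open>The derivative of the skew \<open>\<theta>\<close> is skew; with \<open>T_skew\<close>
  this makes \<open>\<tau>\<close> a 3-form.\<close>

lemma T_adjoint:
  assumes "X \<in> V" "Y \<in> V" "Z \<in> V"
  shows "ip (T X Y) Z p = - ip (T X Z) Y p"
  using vderiv_J_skew[OF assms, of p] assms J_skew[of "D X Y" Z p] J_skew[of "D X Z" Y p]
    ip_commute[of Y "J (D X Z)" p] ip_commute[of Y "D X (J Z)" p] ip_commute[of "J Y" "D X Z" p]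
  by (simp add: vderiv_ip cov_deriv_endo_def)

definition \<Phi> where "\<Phi> X Y = ip (D X \<xi>) Y"

lemma Phi_smooth [simp]: "\<lbrakk>X \<in> V; Y \<in> V\<rbrakk> \<Longrightarrow> \<Phi> X Y \<in> C"
  by (simp add: \<Phi>_def)

lemma Phi_xi [simp]: "X \<in> V \<Longrightarrow> ip (D X \<xi>) \<xi> p = 0" "X \<in> V \<Longrightarrow> ip \<xi> (D X \<xi>) p = 0"
proof -
  assume X: "X \<in> V"
  have "ip \<xi> \<xi> = (\<lambda>p. 1)" by (rule ext) simp
  then show "ip (D X \<xi>) \<xi> p = 0" using vderiv_ip[of X \<xi> \<xi> p] X ip_commute[of \<xi> "D X \<xi>" p] by simp
  then show "ip \<xi> (D X \<xi>) p = 0" using X ip_commute by simp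
qed

lemma T_xi: "X \<in> V \<Longrightarrow> T X \<xi> = - J (D X \<xi>)"
  by (simp add: cov_deriv_endo_def)

text \<open>By \<open>T_skew\<close>, \<open>T \<xi> \<xi> = - J (D \<xi> \<xi>)\<close> vanishes,
  and \<open>J\<close> preserves the length of \<open>D \<xi> \<xi>\<close>, which is orthogonal to
  \<open>\<xi>\<close>.\<close>

lemma D_xi_xi [simp]: "D \<xi> \<xi> = 0"
proof (rule ip_definite)
  fix p
  have "ip (T \<xi> \<xi>) (J (D \<xi> \<xi>)) p = ip (- T \<xi> \<xi>) (J (D \<xi> \<xi>)) p"
    by (rule arg_cong[OF T_skew]) simp_all
  then have "ip (J (D \<xi> \<xi>)) (J (D \<xi> \<xi>)) p = 0" by (simp add: T_xi)
  then show "ip (D \<xi> \<xi>) (D \<xi> \<xi>) p = 0" by (simp add: ip_J_J)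
qed simp

text \<open>The covariant derivative of \<open>\<theta>\<^sup>2 = - Id + \<eta> \<otimes> \<xi>\<close>.\<close>

lemma T_J:
  assumes "X \<in> V" "Y \<in> V"
  shows "T X (J Y) + J (T X Y) = vscale (\<Phi> X Y) \<xi> + vscale (ip Y \<xi>) (D X \<xi>)"
proof -
  have "T X (J Y) + J (T X Y) = D X (J (J Y)) - J (J (D X Y))"
    using assms by (simp add: cov_deriv_endo_def)
  also have "\<dots> = vscale (vderiv X (ip Y \<xi>)) \<xi> + vscale (ip Y \<xi>) (D X \<xi>) - vscale (ip (D X Y) \<xi>) \<xi>"
    using assms by (simp add: J_J)
  also have "\<dots> = vscale (\<Phi> X Y) \<xi> + vscale (ip Y \<xi>) (D X \<xi>)"
    using assms ip_commute[of Y "D X \<xi>"]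
    by (auto simp: fun_eq_iff vscale_def tscale_def \<Phi>_def vderiv_ip algebra_simps)
  finally show ?thesis .
qed

lemma ip_T_xi:
  assumes "X \<in> V" "Y \<in> V"
  shows "ip (T X Y) \<xi> p = ip (J (D X \<xi>)) Y p"
  using T_adjoint[of X Y \<xi> p] assms by (simp add: T_xi)

lemma ip_J_D_xi_skew:
  assumes "X \<in> V" "Y \<in> V"
  shows "ip (J (D X \<xi>)) Y p = - ip (J (D Y \<xi>)) X p"
  using ip_T_xi[of X Y p] ip_T_xi[of Y X p] T_skew[of X Y] assms by simp

text \<open>This is \<open>T_J\<close> in direction \<open>\<xi>\<close>, with
  \<open>T \<xi> X\<close> rewritten as \<open>J (D X \<xi>)\<close> by skewness; the right side
  vanishes because \<open>D \<xi> \<xi> = 0\<close>.\<close>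

lemma D_J_xi:
  assumes "X \<in> V" "Y \<in> V"
  shows "ip (J (D (J X) \<xi>)) Y p = ip (D X \<xi>) Y p"
proof -
  have "T \<xi> X = J (D X \<xi>)" "T \<xi> (J X) = J (D (J X) \<xi>)"
    using T_skew[of X \<xi>] T_skew[of "J X" \<xi>] assms by (simp_all add: T_xi)
  then have "J (D (J X) \<xi>) + J (J (D X \<xi>)) = vscale (\<Phi> \<xi> X) \<xi> + vscale (ip X \<xi>) (D \<xi> \<xi>)"
    using T_J[of \<xi> X] assms by simp
  then have "ip (J (D (J X) \<xi>) + J (J (D X \<xi>))) Y p
      = ip (vscale (\<Phi> \<xi> X) \<xi> + vscale (ip X \<xi>) (D \<xi> \<xi>)) Y p" by simp
  then show ?thesis using assms by (simp add: J_J \<Phi>_def)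
qed

text \<open>That is, \<open>\<xi>\<close> is a Killing field: \<open>D_J_xi\<close> turns the
  skewness of \<open>ip (J (D X \<xi>)) Y\<close> into that of \<open>\<Phi>\<close>.\<close>

lemma Phi_skew:
  assumes "X \<in> V" "Y \<in> V"
  shows "\<Phi> Y X p = - \<Phi> X Y p"
  using D_J_xi[OF assms, of p] ip_J_D_xi_skew[of "J X" Y p] ip_J_J[of "D Y \<xi>" X p] assms
  by (simp add: \<Phi>_def)

lemma Phi_J:
  assumes "X \<in> V" "Y \<in> V"
  shows "\<Phi> X (J Y) p = \<Phi> (J X) Y p"
  using J_skew[of "D X \<xi>" Y p] J_skew[of "D Y \<xi>" X p] ip_J_D_xi_skew[OF assms, of p]
    Phi_skew[of "J X" Y p] assms by (simp add: \<Phi>_def)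

lemma ip_T_xi_Phi: "\<lbrakk>X \<in> V; Y \<in> V\<rbrakk> \<Longrightarrow> ip (T X Y) \<xi> p = - \<Phi> X (J Y) p"
  using J_skew[of "D X \<xi>" Y p] by (simp add: ip_T_xi \<Phi>_def)

section \<open>The second derivative of \<open>\<theta>\<close>\<close>

lemma D_uminus [simp]:
  assumes "X \<in> V" "Y \<in> V"
  shows "D (- X) Y = - D X Y" "D X (- Y) = - D X Y"
proof -
  have "D 0 Y = 0" using D_diff(1)[of Y Y Y] assms by simp
  then show "D (- X) Y = - D X Y" using D_diff(1)[of 0 X Y] assms by simp
  show "D X (- Y) = - D X Y" using D_diff(2)[of X 0 Y] assms by simp
qed

lemma T_uminus [simp]:
  assumes "X \<in> V" "Y \<in> V"
  shows "T (- X) Y = - T X Y" "T X (- Y) = - T X Y"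
  using assms by (simp_all add: cov_deriv_endo_def)

text \<open>\<open>S p X Y Z W\<close> is \<open>(\<nabla>\<^sub>X \<tau>)(Y, Z, W)\<close> at \<open>p\<close>.\<close>

definition S where
  "S p X Y Z W = vderiv X (ip (T Y Z) W) p - ip (T (D X Y) Z) W p - ip (T Y (D X Z)) W p
    - ip (T Y Z) (D X W) p"

lemma S_skew23:
  assumes "X \<in> V" "Y \<in> V" "Z \<in> V" "W \<in> V"
  shows "S p X Z Y W = - S p X Y Z W"
proof -
  have "ip (T Z Y) W = (\<lambda>p. - ip (T Y Z) W p)"
    using assms T_skew[of Y Z] by (intro ext) simp
  then show ?thesis
    using assms T_skew[of Y Z] T_skew[of "D X Y" Z] T_skew[of Y "D X Z"] by (simp add: S_def)
qed

lemma S_skew34: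
  assumes "X \<in> V" "Y \<in> V" "Z \<in> V" "W \<in> V"
  shows "S p X Y W Z = - S p X Y Z W"
proof -
  have "ip (T Y W) Z = (\<lambda>p. - ip (T Y Z) W p)"
    using assms T_adjoint[of Y W Z] by (intro ext) simp
  then show ?thesis
    using assms T_adjoint[of "D X Y" Z W p] T_adjoint[of Y "D X Z" W p] T_adjoint[of Y "D X W" Z p]
    by (simp add: S_def)
qed

text \<open>The curvature acts on the endomorphism \<open>\<theta>\<close> by commutator; skewness
  of \<open>\<theta>\<close> moves \<open>J\<close> onto \<open>W\<close>, which makes both signs
  positive.\<close>

lemma ricci:
  assumes "X \<in> V" "Y \<in> V" "Z \<in> V" "W \<in> V"
  shows "S p X Y Z W - S p Y X Z W
    = curvature A g D X Y (J Z) W p + curvature A g D X Y Z (J W) p"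
proof -
  have "S p X Y Z W = ip (D X (T Y Z)) W p - ip (T (D X Y) Z) W p - ip (T Y (D X Z)) W p"
    if "X \<in> V" "Y \<in> V" for X Y
    using assms that by (simp add: S_def vderiv_ip)
  then show ?thesis
    using assms by (simp add: cov_deriv_endo_def curvature_eq J_skew)
qed

text \<open>Orthogonality is required everywhere, not only at one point, so that
  \<open>ip X \<xi> = 0\<close> can be differentiated.\<close>

definition F where "F = {X \<in> V. ip X \<xi> = (\<lambda>p. 0)}"

lemma F_xi_fun [simp]: "X \<in> F \<Longrightarrow> ip X \<xi> = (\<lambda>p. 0)"
  by (simp add: F_def)

lemma J_F [simp]: "X \<in> F \<Longrightarrow> J X \<in> F"
  unfolding F_def by auto

lemma F_V [simp]: "X \<in> F \<Longrightarrow> X \<in> V"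
  unfolding F_def by simp


lemma J_J_F [simp]: "X \<in> F \<Longrightarrow> J (J X) = - X"
  by (simp add: J_J)

lemma T_J_F: "\<lbrakk>X \<in> F; Y \<in> F\<rbrakk> \<Longrightarrow> T X (J Y) = vscale (\<Phi> X Y) \<xi> - J (T X Y)"
  unfolding eq_diff_eq by (subst T_J) simp_all

text \<open>In \<open>T_J_F\<close> the right side is skew in \<open>X\<close> and \<open>Y\<close>,
  hence so is \<open>T X (J Y)\<close>.\<close>

lemma T_J_commute:
  assumes "X \<in> F" "Y \<in> F"
  shows "T (J X) Y = T X (J Y)"
proof -
  have "\<Phi> Y X = (\<lambda>p. - \<Phi> X Y p)" using assms Phi_skew[of X Y] by (intro ext) simp
  then have "vscale (\<Phi> Y X) \<xi> = - vscale (\<Phi> X Y) \<xi>"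
    by (intro ext) (simp add: vscale_def tscale_def)
  moreover have "T (J X) Y = - T Y (J X)" using assms by (simp add: T_skew[of Y "J X"])
  ultimately show ?thesis using assms T_skew[of X Y] by (simp add: T_J_F)
qed

definition q where "q p X Y Z W = ip (T X Y) (T Z W) p + \<Phi> X Y p * \<Phi> Z W p"

text \<open>Moving \<open>J\<close> out of \<open>T\<close> leaves multiples of
  \<open>\<xi>\<close>, whose products with the other factor are the \<open>\<Phi>\<close>-terms
  that the second summand of \<open>q\<close> absorbs.\<close>

lemma q_J_skew:
  assumes "X \<in> F" "Y \<in> F" "Z \<in> F" "W \<in> F"
  shows "q p X (J Y) Z W = - q p X Y Z (J W)"
  using assms J_skew[of "T X Y" "T Z W" p] ip_T_xi_Phi[of X Y p] ip_T_xi_Phi[of Z W p]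
    ip_commute[of \<xi> "T Z W" p]
  by (simp add: q_def T_J_F)

lemma S_J:
  assumes "X \<in> F" "Y \<in> F" "Z \<in> F" "W \<in> F"
  shows "S p X Y (J Z) W - S p X Y Z (J W) = q p Y W X Z + q p Y Z X W"
proof -
  \<comment> \<open>\<open>T_J\<close> tested against \<open>W\<close>, on all of \<open>V\<close>
    because it is applied to \<open>D X Y\<close>, \<open>D X Z\<close> and \<open>D X W\<close>,
    which may leave \<open>F\<close>.\<close>
  have B: "ip (T Y (J Z)) W p - ip (T Y Z) (J W) p
      = \<Phi> Y Z p * ip W \<xi> p + ip Z \<xi> p * \<Phi> Y W p"
    if "Y \<in> V" "Z \<in> V" "W \<in> V" for Y Z W p
  proof -
    have "ip (T Y (J Z) + J (T Y Z)) W p = ip (vscale (\<Phi> Y Z) \<xi> + vscale (ip Z \<xi>) (D Y \<xi>)) W p"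
      using T_J that by simp
    then show ?thesis using that J_skew[of "T Y Z" W p] ip_commute[of \<xi> W p] by (simp add: \<Phi>_def)
  qed
  have eq: "ip (T Y (J Z)) W = ip (T Y Z) (J W)"
    using B[of Y Z W] assms by (intro ext) simp
  \<comment> \<open>Differentiating \<open>ip Z \<xi> = 0\<close> shows how far \<open>D X Z\<close>
    leaves \<open>F\<close>; through \<open>B\<close> this yields the \<open>\<Phi>\<close>-products
    in \<open>q\<close>.\<close>
  have orth: "ip (D X Z) \<xi> p = - \<Phi> X Z p" if "X \<in> F" "Z \<in> F" for X Z
  proof -
    have "vderiv X (ip Z \<xi>) p = ip (D X Z) \<xi> p + ip Z (D X \<xi>) p"
      using that by (simp only: vderiv_ip F_V xi_closed)
    then show ?thesis using that ip_commute[of Z "D X \<xi>" p] by (simp add: \<Phi>_def)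
  qed
  \<comment> \<open>The extra \<open>T X Z\<close> gives \<open>T Y (T X Z)\<close>, which
    \<open>T_adjoint\<close> turns into the \<open>T\<close>-products in \<open>q\<close>.\<close>
  have D_J: "D X (J Z) = T X Z + J (D X Z)" for Z by (simp add: cov_deriv_endo_def)
  have T_add: "T Y (U + U') = T Y U + T Y U'" if "U \<in> V" "U' \<in> V" for U U'
    using assms that by (simp add: cov_deriv_endo_def)
  show ?thesis
    using assms B[of "D X Y" Z W p] B[of Y "D X Z" W p] B[of Y Z "D X W" p] orth
      T_adjoint[of Y "T X Z" W p]
    by (simp add: S_def eq D_J T_add q_def algebra_simps)
qed

lemma curvature_uminus:
  "\<lbrakk>X \<in> V; Y \<in> V; Z \<in> V; W \<in> V\<rbrakk> \<Longrightarrow> curvature A g D (- X) Y Z W p = - curvature A g D X Y Z W p"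
  by (simp add: curvature_eq)

lemma F_algebra: "nearly_kaehler_algebra F J (\<lambda>X Y Z W. curvature A g D X Y Z W p) (S p) (q p)"
proof
  fix X Y Z W
  assume F: "X \<in> F" "Y \<in> F" "Z \<in> F" "W \<in> F"
  then have V: "X \<in> V" "Y \<in> V" "Z \<in> V" "W \<in> V" by simp_all
  show "J X \<in> F" using F by simp
  show "curvature A g D Y X Z W p = - curvature A g D X Y Z W p" by (rule curvature_skew12[OF V])
  show "curvature A g D X Y W Z p = - curvature A g D X Y Z W p" by (rule curvature_skew34[OF V])
  show "curvature A g D Z W X Y p = curvature A g D X Y Z W p" by (rule curvature_pair[OF V])
  show "curvature A g D X Y Z W p + curvature A g D Y Z X W p + curvature A g D Z X Y W p = 0"
    by (rule curvature_bianchi[OF V])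
  show "curvature A g D (J (J X)) Y Z W p = - curvature A g D X Y Z W p"
    using F V by (simp add: curvature_uminus)
  show "S p X Z Y W = - S p X Y Z W" by (rule S_skew23[OF V])
  show "S p X Y W Z = - S p X Y Z W" by (rule S_skew34[OF V])
  show "q p Y X Z W = - q p X Y Z W"
    using V T_skew[of X Y] Phi_skew[of X Y p] by (simp add: q_def)
  show "q p Z W X Y = q p X Y Z W"
    using V ip_commute[of "T X Y" "T Z W" p] by (simp add: q_def)
  show "q p X Y Z (J W) = q p X Y (J Z) W"
    using F V T_J_commute[of Z W] Phi_J[of Z W p] by (simp add: q_def)
  show "q p X (J Y) Z W = - q p X Y Z (J W)" by (rule q_J_skew[OF F])
  show "q p X Y Z (J (J W)) = - q p X Y Z W" using F V by (simp add: q_def \<Phi>_def)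
  show "S p X Y Z W - S p Y X Z W
    = curvature A g D X Y (J Z) W p + curvature A g D X Y Z (J W) p" by (rule ricci[OF V])
  show "S p X Y (J Z) W - S p X Y Z (J W) = q p Y W X Z + q p Y Z X W" by (rule S_J[OF F])
qed

section \<open>Reduction to fields orthogonal to \<open>\<xi>\<close> everywhere\<close>

definition hor where "hor X = X - vscale (ip X \<xi>) \<xi>"

lemma hor_F [simp]: "X \<in> V \<Longrightarrow> hor X \<in> F"
  unfolding F_def hor_def by auto

lemma J_hor: "X \<in> V \<Longrightarrow> J (hor X) = J X"
  by (simp add: hor_def)

lemma vscale_zero_at: "f p = 0 \<Longrightarrow> vscale f X p = 0"
  by (rule ext) (simp add: vscale_def tscale_def)

lemma hor_at: "ip X \<xi> p = 0 \<Longrightarrow> hor X p = X p"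
  by (simp add: hor_def vscale_zero_at)

lemma D_hor: "\<lbrakk>X \<in> V; ip X \<xi> p = 0; Y \<in> V\<rbrakk> \<Longrightarrow> D (hor X) Y p = D X Y p"
  by (simp add: hor_def vscale_zero_at)

lemma T_hor_left: "\<lbrakk>X \<in> V; ip X \<xi> p = 0; Y \<in> V\<rbrakk> \<Longrightarrow> T (hor X) Y p = T X Y p"
proof -
  \<comment> \<open>Spelled out at \<open>p\<close>, since \<open>D_hor\<close> is an equality only
    there.\<close>
  have "T U Y p = D U (J Y) p - \<theta> p (D U Y p)" for U
    unfolding cov_deriv_endo_def minus_apply by (simp only: endo_app_def)
  then show "\<lbrakk>X \<in> V; ip X \<xi> p = 0; Y \<in> V\<rbrakk> \<Longrightarrow> ?thesis" by (simp add: D_hor)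
qed

text \<open>Skewness moves the second argument into the first slot, where \<open>T\<close> depends
  only on the value at \<open>p\<close>.\<close>

lemma T_hor:
  assumes "X \<in> V" "ip X \<xi> p = 0" "Y \<in> V" "ip Y \<xi> p = 0"
  shows "T (hor X) (hor Y) p = T X Y p"
proof -
  have "T (hor X) (hor Y) p = T X (hor Y) p" using assms by (simp add: T_hor_left)
  also have "\<dots> = - T (hor Y) X p" using assms by (simp add: T_skew[of "hor Y" X])
  also have "\<dots> = T X Y p" using assms by (simp add: T_hor_left T_skew[of Y X])
  finally show ?thesis .
qed

lemma curvature_hor12:
  assumes "X \<in> V" "ip X \<xi> p = 0" "Y \<in> V" "ip Y \<xi> p = 0" "Z \<in> V" "W \<in> V"
  shows "curvature A g D (hor X) (hor Y) Z W p = curvature A g D X Y Z W p"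
proof -
  have hor1: "curvature A g D (hor X) Y Z W p = curvature A g D X Y Z W p"
    if "X \<in> V" "ip X \<xi> p = 0" "Y \<in> V" for X Y
    using that assms(5,6) by (simp add: hor_def curvature_tensor)
  have "curvature A g D (hor X) (hor Y) Z W p = curvature A g D X (hor Y) Z W p"
    using assms by (simp add: hor1)
  also have "\<dots> = - curvature A g D (hor Y) X Z W p"
    using assms by (intro curvature_skew12) simp_all
  also have "\<dots> = - curvature A g D Y X Z W p"
    using assms by (simp add: hor1)
  also have "\<dots> = curvature A g D X Y Z W p"
    using assms curvature_skew12[of X Y Z W p] by simp
  finally show ?thesis .
qed

lemma curvature_identity:
  assumes X: "X \<in> V" "ip X \<xi> p = 0" and Y: "Y \<in> V" "ip Y \<xi> p = 0"
    and Z: "Z \<in> V" "ip Z \<xi> p = 0" and W: "W \<in> V" "ip W \<xi> p = 0"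
  shows "curvature A g D Y X W Z p - curvature A g D Y X (J W) (J Z) p
    = - ip (T W Z) (T Y X) p + ip Y (D X \<xi>) p * ip Z (D W \<xi>) p"
proof -
  have "curvature A g D (hor Y) (hor X) (hor W) (hor Z) p
      - curvature A g D (hor Y) (hor X) (J (hor W)) (J (hor Z)) p = - q p (hor Y) (hor X) (hor W) (hor Z)"
    using nearly_kaehler_algebra.curvature_identity[OF F_algebra, of "hor Y" "hor X" "hor W" "hor Z" p]
      X Y Z W by simp
  \<comment> \<open>\<open>curvature_hor12\<close> treats the first pair; pair symmetry brings the
    second pair into its place.\<close>
  moreover have "curvature A g D (hor Y) (hor X) (hor W) (hor Z) p = curvature A g D Y X W Z p"
  proof -
    have "curvature A g D (hor Y) (hor X) (hor W) (hor Z) p = curvature A g D Y X (hor W) (hor Z) p"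
      using assms by (simp add: curvature_hor12)
    also have "\<dots> = curvature A g D (hor W) (hor Z) Y X p"
      using assms by (intro curvature_pair) simp_all
    also have "\<dots> = curvature A g D W Z Y X p" using assms by (simp add: curvature_hor12)
    also have "\<dots> = curvature A g D Y X W Z p" using assms by (intro curvature_pair)
    finally show ?thesis .
  qed
  moreover have "curvature A g D (hor Y) (hor X) (J (hor W)) (J (hor Z)) p
      = curvature A g D Y X (J W) (J Z) p"
    using assms by (simp add: curvature_hor12 J_hor)
  moreover have "q p (hor Y) (hor X) (hor W) (hor Z)
      = ip (T W Z) (T Y X) p - ip Y (D X \<xi>) p * ip Z (D W \<xi>) p"
  proof -
    have "q p (hor Y) (hor X) (hor W) (hor Z) = ip (T Y X) (T W Z) p + \<Phi> Y X p * \<Phi> W Z p"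
      using assms by (simp add: q_def ip_def \<Phi>_def T_hor D_hor hor_at)
    \<comment> \<open>Only the first factor is transposed by \<open>Phi_skew\<close>, which produces
      the plus sign before the last product of the identity.\<close>
    moreover have "\<Phi> Y X p = - ip Y (D X \<xi>) p" "\<Phi> W Z p = ip Z (D W \<xi>) p"
      using assms Phi_skew[of X Y p] ip_commute[of Y "D X \<xi>" p] ip_commute[of Z "D W \<xi>" p]
      by (simp_all add: \<Phi>_def)
    ultimately show ?thesis using assms ip_commute[of "T Y X" "T W Z" p] by simp
  qed
  ultimately show ?thesis by simp
qed

end

theorem proposition4p1:
  fixes A :: "('m::{t2_space, second_countable_topology}, 'e::euclidean_space) atlas"
    and n :: nat
    and g :: "'m \<Rightarrow> 'm tangent \<Rightarrow> 'm tangent \<Rightarrow> real"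
    and D :: "'m vfield \<Rightarrow> 'm vfield \<Rightarrow> 'm vfield"
    and \<theta> :: "'m \<Rightarrow> 'm tangent \<Rightarrow> 'm tangent"
    and \<xi> :: "'m vfield"
    and \<eta> :: "'m \<Rightarrow> 'm tangent \<Rightarrow> real"
    and X Y Z W :: "'m vfield"
    and p :: 'm
  assumes "smooth_atlas A"
    and "DIM('e) = 2 * n + 1"
    and "riemannian_metric A g"
    and "levi_civita_connection A g D"
    and "nearly_cosymplectic A g D \<theta> \<xi> \<eta>"
    and "X \<in> vfields A" and "Y \<in> vfields A" and "Z \<in> vfields A" and "W \<in> vfields A"
    and "X p \<in> orth_distribution A g \<xi> p" and "Y p \<in> orth_distribution A g \<xi> p"
    and "Z p \<in> orth_distribution A g \<xi> p" and "W p \<in> orth_distribution A g \<xi> p"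
  shows "curvature A g D Y X W Z p - curvature A g D Y X (endo_app \<theta> W) (endo_app \<theta> Z) p
    = - g p (cov_deriv_endo D \<theta> W Z p) (cov_deriv_endo D \<theta> Y X p)
      + g p (Y p) (D X \<xi> p) * g p (Z p) (D W \<xi> p)"
proof -
  interpret nearly_cosymplectic_manifold A g D \<theta> \<xi> \<eta>
    using assms(1,3,4,5) by unfold_locales
  show ?thesis
    using curvature_identity[of X p Y Z W] assms(6-13) by (simp add: orth_distribution_def ip_def)
qed

end
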